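(* Let $\rho>2H$, and let $(x_1^k,\dots,x_n^k,z^k,y^k)_{k\ge 0}$ be a sequence generated by the ADMM iteration described in the context. If this sequence is bounded, then: (a) (Residual convergence) $r^k\to 0$ as $k\to\infty$, where $r^k=\sum_{i=1}^n A_i x_i^k-z^k$. (b) (Objective convergence) $F(x_1^k,\dots,x_n^k,z^k)=f(x_1^k,\dots,x_n^k)+h(z^k)$ converges as $k\to\infty$.
   Context: Problem: minimize $F(x_1,\dots,x_n,z)=f(x_1,\dots,x_n)+h(z)$ over $x_i\in\mathbb{R}^{p_i}$ ($i=1,\dots,n$), $z\in\mathbb{R}^q$, subject to $\sum_{i=1}^n A_ix_i-z=0$, where $A_i\in\mathbb{R}^{q\times p_i}$ are matrices; $f:\mathbb{R}^p\to\mathbb{R}\cup\{\infty\}$ ($p=\sum_i p_i$) is proper, continuous, possibly nonsmooth, and multi-convex (i.e. convex in each $x_i$ when all the other variables are fixed); $h:\mathbb{R}^q\to\mathbb{R}$ is proper, differentiable and convex. Standing assumptions: the objective of the problem is bounded from below on the feasible set; $h$ is Lipschitz differentiable with constant $H\ge 0$, i.e. $\|\nabla h(z')-\nabla h(z'')\|\le H\|z'-z''\|$ for all $z',z''\in\mathbb{R}^q$. Augmented Lagrangian, for a penalty parameter $\rho>0$ and dual variable $y\in\mathbb{R}^q$: $L_\rho(x_1,\dots,x_n,z,y)=f(x_1,\dots,x_n)+h(z)+y^T(\sum_{i=1}^nA_ix_i-z)+\frac{\rho}{2}\|\sum_{i=1}^nA_ix_i-z\|_2^2$. ADMM iteration (run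 indefinitely, from an initial point $(x_1^0,\dots,x_n^0,z^0,y^0)$): for $k=0,1,2,\dots$, first for $i=1,\dots,n$ in order, $x_i^{k+1}$ is a minimizer over $x_i$ of $L_\rho(x_1^{k+1},\dots,x_{i-1}^{k+1},x_i,x_{i+1}^k,\dots,x_n^k,z^k,y^k)$; then $z^{k+1}$ is a minimizer over $z$ of $L_\rho(x_1^{k+1},\dots,x_n^{k+1},z,y^k)$; then $r^{k+1}=\sum_{i=1}^nA_ix_i^{k+1}-z^{k+1}$ and $y^{k+1}=y^k+\rho r^{k+1}$. Each subproblem is assumed to be solvable (the minimum is attained, with finite value). *)

theory Defs
  imports "HOL-Analysis.Analysis"
begin

text \<open>
  The space \<open>R^p = R^(p_1) \<times> ... \<times> R^(p_n)\<close> is \<open>real ^ 'p\<close> together with a map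
  \<open>blk :: 'p \<Rightarrow> nat\<close> into \<open>{1..n}\<close>, where \<open>blk j\<close> is the block to which coordinate \<open>j\<close> belongs.
  Thus \<open>p_i\<close> is the cardinality of \<open>{j. blk j = i}\<close>, and \<open>x_i\<close> consists of the coordinates
  \<open>x $ j\<close> with \<open>blk j = i\<close>. The block \<open>x_i\<close> is embedded in \<open>real ^ 'p\<close> by zero padding.
\<close>

definition block :: "('p::finite \<Rightarrow> nat) \<Rightarrow> nat \<Rightarrow> real ^ 'p \<Rightarrow> real ^ 'p" where
  "block blk i x = (\<chi> j. if blk j = i then x $ j else 0)"

definition put_block :: "('p::finite \<Rightarrow> nat) \<Rightarrow> nat \<Rightarrow> real ^ 'p \<Rightarrow> real ^ 'p \<Rightarrow> real ^ 'p" where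
  "put_block blk i w x = (\<chi> j. if blk j = i then w $ j else x $ j)"

text \<open>\<open>(u_1, ..., u_(i-1), v_i, ..., v_n)\<close>:\<close>

definition sweep_point :: "('p::finite \<Rightarrow> nat) \<Rightarrow> nat \<Rightarrow> real ^ 'p \<Rightarrow> real ^ 'p \<Rightarrow> real ^ 'p" where
  "sweep_point blk i u v = (\<chi> j. if blk j < i then u $ j else v $ j)"

text \<open>
  \<open>A i\<close> represents a \<open>q \<times> p_i\<close> matrix: only its columns \<open>j\<close> with \<open>blk j = i\<close> matter, since
  the other coordinates of \<open>block blk i x\<close> vanish.
\<close>

definition residual ::
  "nat \<Rightarrow> ('p::finite \<Rightarrow> nat) \<Rightarrow> (nat \<Rightarrow> real ^ 'p ^ 'q::finite) \<Rightarrow> real ^ 'p \<Rightarrow> real ^ 'q \<Rightarrow> real ^ 'q"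
where
  "residual n blk A x z = (\<Sum>i=1..n. A i *v block blk i x) - z"

definition objective ::
  "(real ^ 'p::finite \<Rightarrow> ereal) \<Rightarrow> (real ^ 'q::finite \<Rightarrow> real) \<Rightarrow> real ^ 'p \<Rightarrow> real ^ 'q \<Rightarrow> ereal"
where
  "objective f h x z = f x + ereal (h z)"

definition aug_lagrangian ::
  "nat \<Rightarrow> ('p::finite \<Rightarrow> nat) \<Rightarrow> (nat \<Rightarrow> real ^ 'p ^ 'q::finite) \<Rightarrow>
   (real ^ 'p \<Rightarrow> ereal) \<Rightarrow> (real ^ 'q \<Rightarrow> real) \<Rightarrow> real \<Rightarrow>
   real ^ 'p \<Rightarrow> real ^ 'q \<Rightarrow> real ^ 'q \<Rightarrow> ereal"
where
  "aug_lagrangian n blk A f h \<rho> x z y =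
     f x + ereal (h z) + ereal (y \<bullet> residual n blk A x z)
       + ereal (\<rho> / 2 * (norm (residual n blk A x z))\<^sup>2)"

definition proper_fun :: "('a \<Rightarrow> ereal) \<Rightarrow> bool" where
  "proper_fun f \<longleftrightarrow> (\<forall>x. f x \<noteq> -\<infinity>) \<and> (\<exists>x. f x \<noteq> \<infinity>)"

text \<open>
  Continuity relative to the effective domain, so that indicator functions of constraint sets are
  admitted. A function that is continuous into \<open>ereal\<close> on the whole space satisfies this as well.
\<close>

definition continuous_on_dom :: "('a::topological_space \<Rightarrow> ereal) \<Rightarrow> bool" where
  "continuous_on_dom f \<longleftrightarrow> continuous_on {x. f x \<noteq> \<infinity>} f"

text \<open>Note that \<open>0 * \<infinity> = 0\<close> in \<open>ereal\<close>, so the cases \<open>t = 0\<close> and \<open>t = 1\<close> are trivial.\<close>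

definition convex_fun :: "('a::real_vector \<Rightarrow> ereal) \<Rightarrow> bool" where
  "convex_fun g \<longleftrightarrow>
     (\<forall>u v. \<forall>t\<in>{0..1}. g ((1 - t) *\<^sub>R u + t *\<^sub>R v) \<le> ereal (1 - t) * g u + ereal t * g v)"

definition multi_convex ::
  "nat \<Rightarrow> ('p::finite \<Rightarrow> nat) \<Rightarrow> (real ^ 'p \<Rightarrow> ereal) \<Rightarrow> bool"
where
  "multi_convex n blk f \<longleftrightarrow> (\<forall>i\<in>{1..n}. \<forall>x. convex_fun (\<lambda>w. f (put_block blk i w x)))"

text \<open>
  In the \<open>i\<close>-th block update, \<open>put_block blk i w (sweep_point ...)\<close> depends on \<open>w\<close> only through
  its block \<open>i\<close>; hence \<open>is_arg_min\<close> says that block \<open>i\<close> of \<open>x (Suc k)\<close> is a minimizer, and does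
  not constrain the other blocks. The minimal value never is \<open>-\<infinity>\<close> for proper \<open>f\<close>, so finiteness
  amounts to being different from \<open>\<infinity>\<close>.
\<close>

definition admm_sequence ::
  "nat \<Rightarrow> ('p::finite \<Rightarrow> nat) \<Rightarrow> (nat \<Rightarrow> real ^ 'p ^ 'q::finite) \<Rightarrow>
   (real ^ 'p \<Rightarrow> ereal) \<Rightarrow> (real ^ 'q \<Rightarrow> real) \<Rightarrow> real \<Rightarrow>
   (nat \<Rightarrow> real ^ 'p) \<Rightarrow> (nat \<Rightarrow> real ^ 'q) \<Rightarrow> (nat \<Rightarrow> real ^ 'q) \<Rightarrow> bool"
where
  "admm_sequence n blk A f h \<rho> x z y \<longleftrightarrow>
     (\<forall>k.
        (\<forall>i\<in>{1..n}.
           let \<phi> = (\<lambda>w. aug_lagrangian n blk A f h \<rho>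
                      (put_block blk i w (sweep_point blk i (x (Suc k)) (x k))) (z k) (y k))
           in is_arg_min \<phi> (\<lambda>_. True) (x (Suc k)) \<and> \<phi> (x (Suc k)) \<noteq> \<infinity>)
      \<and> (let \<psi> = (\<lambda>v. aug_lagrangian n blk A f h \<rho> (x (Suc k)) v (y k))
         in is_arg_min \<psi> (\<lambda>_. True) (z (Suc k)) \<and> \<psi> (z (Suc k)) \<noteq> \<infinity>)
      \<and> y (Suc k) = y k + \<rho> *\<^sub>R residual n blk A (x (Suc k)) (z (Suc k)))"

end

theory Submission
  imports Defs
begin

text \<open>
  The augmented Lagrangian \<open>L k = L\<^sub>\<rho>(x k, z k, y k)\<close> is a Lyapunov function of the iteration.
  Everything rests on the identity \<open>y k = grad_h (z k)\<close> for \<open>k \<ge> 1\<close>: the optimality condition of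
  the \<open>z\<close>-update reads \<open>grad_h (z (k+1)) = y k + \<rho> r (k+1)\<close>, and the right-hand side is \<open>y (k+1)\<close>
  (lemma \<open>z_step_gradient\<close>). It lets the primal variable \<open>z\<close> control the dual variable \<open>y\<close>.

  Decrease. The block updates never increase the augmented Lagrangian, because each of them
  minimizes it over one block (lemma \<open>x_sweep_descent\<close>). The
  \<open>z\<close>-subproblem is \<open>\<rho>\<close>-strongly convex, so the
  \<open>z\<close>-update lowers it by at least \<open>\<rho>/2 * (norm (z (k+1) - z k))\<^sup>2\<close> (lemma \<open>z_step_descent\<close>). The dual
  ascent step raises it by \<open>(norm (y (k+1) - y k))\<^sup>2 / \<rho>\<close>, which is at most
  \<open>H\<^sup>2/\<rho> * (norm (z (k+1) - z k))\<^sup>2\<close> for \<open>k \<ge> 1\<close> by the Lipschitz bound on \<open>grad_h\<close>.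
  As \<open>\<rho> > 2 * H\<close>, the net effect
  is a decrease by a fixed positive multiple of \<open>(norm (z (k+1) - z k))\<^sup>2\<close>.

  Lower bound. Replacing \<open>z k\<close> by the feasible \<open>z' = \<Sum>i. A i x\<^sub>i\<close> raises \<open>h\<close> by at most
  \<open>y k \<bullet> r k + H * (norm (r k))\<^sup>2\<close>, and \<open>H \<le> \<rho>/2\<close>, so \<open>L k\<close> is at least the objective at a feasible
  point (lemma \<open>convex_lipschitz_gradient_upper_bound\<close>).

  Consequently \<open>L k\<close> converges and \<open>z (k+1) - z k\<close> tends to \<open>0\<close>, hence so do \<open>y (k+1) - y k\<close> and
  \<open>r (k+1) = (y (k+1) - y k) / \<rho>\<close>. Since \<open>y\<close> is bounded, the objective differs from \<open>L k\<close> by a null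
  sequence.
\<close>

section \<open>Convex functions with a Lipschitz gradient\<close>

lemma convex_on_compose_affine_line:
  fixes h :: "'a::real_vector \<Rightarrow> real"
  assumes "convex_on UNIV h"
  shows "convex_on UNIV (\<lambda>t. h (a + t *\<^sub>R d))"
proof (rule convex_onI)
  fix t s r :: real
  assume "0 < t" "t < 1"
  have "a + ((1 - t) *\<^sub>R s + t *\<^sub>R r) *\<^sub>R d = (1 - t) *\<^sub>R (a + s *\<^sub>R d) + t *\<^sub>R (a + r *\<^sub>R d)"
    by (simp add: algebra_simps)
  then show "h (a + ((1 - t) *\<^sub>R s + t *\<^sub>R r) *\<^sub>R d)
      \<le> (1 - t) * h (a + s *\<^sub>R d) + t * h (a + r *\<^sub>R d)"
    using convex_onD[OF assms, of t "a + s *\<^sub>R d" "a + r *\<^sub>R d"] \<open>0 < t\<close> \<open>t < 1\<close> by simp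
qed simp

text \<open>
  Restricting to the line through the two points reduces this to the one-dimensional tangent
  inequality.
\<close>

lemma convex_on_ge_tangent_plane:
  fixes h :: "'a::real_inner \<Rightarrow> real"
  assumes "convex_on UNIV h" and "GDERIV h a :> g"
  shows "h a + g \<bullet> (b - a) \<le> h b"
proof -
  let ?l = "\<lambda>t::real. h (a + t *\<^sub>R (b - a))"
  have "(h has_derivative (\<lambda>v. v \<bullet> g)) (at (a + 0 *\<^sub>R (b - a)))"
    using assms(2) by (simp add: gderiv_def)
  moreover have "((\<lambda>t::real. a + t *\<^sub>R (b - a)) has_derivative (\<lambda>t. t *\<^sub>R (b - a))) (at 0)"
    by (auto intro!: derivative_eq_intros)
  ultimately have "(?l has_derivative (\<lambda>t. (t *\<^sub>R (b - a)) \<bullet> g)) (at 0)"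
    using has_derivative_compose by blast
  then have "(?l has_field_derivative g \<bullet> (b - a)) (at 0)"
    by (simp add: has_field_derivative_def mult_commute_abs inner_commute)
  then have "?l 1 - ?l 0 \<ge> (g \<bullet> (b - a)) * (1 - 0)"
    by (intro convex_on_imp_above_tangent[where A = UNIV]
        convex_on_compose_affine_line[OF assms(1)]) auto
  then show ?thesis by simp
qed

text \<open>
  The tangent inequality at \<open>b\<close> bounds \<open>h b - h a\<close> by \<open>g b \<bullet> (b - a)\<close>, and moving the gradient
  from \<open>b\<close> to \<open>a\<close> costs at most \<open>H * (norm (b - a))\<^sup>2\<close>. The sharp constant is \<open>H / 2\<close>, but this
  one already pairs with the penalty condition \<open>\<rho> > 2 * H\<close>.
\<close>

lemma convex_lipschitz_gradient_upper_bound: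
  fixes h :: "'a::real_inner \<Rightarrow> real"
  assumes "convex_on UNIV h" and "\<And>v. GDERIV h v :> g v" and "H-lipschitz_on UNIV g"
  shows "h b \<le> h a + g a \<bullet> (b - a) + H * (norm (b - a))\<^sup>2"
proof -
  have "h b + g b \<bullet> (a - b) \<le> h a"
    using convex_on_ge_tangent_plane[OF assms(1,2)] .
  moreover have "(g b - g a) \<bullet> (b - a) \<le> norm (g b - g a) * norm (b - a)"
    by (rule norm_cauchy_schwarz)
  moreover have "norm (g b - g a) * norm (b - a) \<le> H * (norm (b - a))\<^sup>2"
    using lipschitz_onD[OF assms(3), of b a]
    by (simp add: dist_norm power2_eq_square mult_right_mono flip: mult.assoc)
  ultimately show ?thesis
    by (simp add: inner_diff_left inner_diff_right)
qed

section \<open>The update of z\<close>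

lemma norm_add_squared:
  fixes a b :: "'a::real_inner"
  shows "(norm (a + b))\<^sup>2 = (norm a)\<^sup>2 + 2 * (a \<bullet> b) + (norm b)\<^sup>2"
  by (simp add: power2_norm_eq_inner inner_add_left inner_add_right inner_commute)

text \<open>
  In this section \<open>c\<close> stands for \<open>\<Sum>i. A i x\<^sub>i\<close>. This is the optimality condition of the
  \<open>z\<close>-subproblem; in the iteration its right-hand side is the new multiplier.
\<close>

lemma z_step_gradient:
  fixes h :: "'a::real_inner \<Rightarrow> real"
  assumes grad: "GDERIV h w :> g"
    and min: "\<And>v. h w + y \<bullet> (c - w) + \<rho> / 2 * (norm (c - w))\<^sup>2
                 \<le> h v + y \<bullet> (c - v) + \<rho> / 2 * (norm (c - v))\<^sup>2"
  shows "g = y + \<rho> *\<^sub>R (c - w)"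
proof -
  let ?\<psi> = "\<lambda>v. h v + y \<bullet> (c - v) + \<rho> / 2 * ((c - v) \<bullet> (c - v))"
  let ?d = "g - y - \<rho> *\<^sub>R (c - w)"
  have "(h has_derivative (\<lambda>v. v \<bullet> g)) (at w)"
    using grad by (simp add: gderiv_def)
  then have "(?\<psi> has_derivative (\<lambda>v. v \<bullet> ?d)) (at w)"
    by (auto intro!: derivative_eq_intros simp: fun_eq_iff algebra_simps inner_diff_left
        inner_diff_right inner_commute)
  then have "(\<lambda>v. v \<bullet> ?d) = (\<lambda>v. 0)"
    by (rule has_derivative_local_min) (use min in \<open>simp add: power2_norm_eq_inner\<close>)
  then have "?d \<bullet> ?d = 0"
    by (rule fun_cong)
  then have "?d = 0"
    by (simp only: inner_eq_zero_iff)
  then show ?thesis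
    by (simp add: algebra_simps)
qed

text \<open>
  Quadratic growth at the minimizer: the linear terms cancel because of the optimality condition,
  and the penalty contributes \<open>\<rho> / 2 * (norm (v - w))\<^sup>2\<close>.
\<close>

lemma z_step_descent:
  fixes h :: "'a::real_inner \<Rightarrow> real"
  assumes "convex_on UNIV h" and "GDERIV h w :> g" and opt: "g = y + \<rho> *\<^sub>R (c - w)"
  shows "h w + y \<bullet> (c - w) + \<rho> / 2 * (norm (c - w))\<^sup>2 + \<rho> / 2 * (norm (v - w))\<^sup>2
      \<le> h v + y \<bullet> (c - v) + \<rho> / 2 * (norm (c - v))\<^sup>2"
proof -
  have "h w + g \<bullet> (v - w) \<le> h v"
    using convex_on_ge_tangent_plane[OF assms(1,2)] .
  moreover have "g \<bullet> (v - w) = y \<bullet> (c - w) - y \<bullet> (c - v) + \<rho> * ((c - w) \<bullet> (v - w))"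
    by (simp add: opt inner_add_left inner_diff_right right_diff_distrib)
  moreover have "(norm (c - v))\<^sup>2 = (norm (c - w))\<^sup>2 - 2 * ((c - w) \<bullet> (v - w)) + (norm (v - w))\<^sup>2"
    using norm_add_squared[of "c - w" "w - v"]
    by (simp add: norm_minus_commute inner_diff_right)
  then have "\<rho> / 2 * (norm (c - v))\<^sup>2
      = \<rho> / 2 * (norm (c - w))\<^sup>2 - \<rho> * ((c - w) \<bullet> (v - w)) + \<rho> / 2 * (norm (v - w))\<^sup>2"
    by (simp only:) (simp add: distrib_left right_diff_distrib)
  ultimately show ?thesis
    by linarith
qed

section \<open>The updates of the blocks\<close>

lemma put_block_sweep_point:
  "put_block blk i u (sweep_point blk i u v) = sweep_point blk (Suc i) u v"
  by (auto simp: put_block_def sweep_point_def vec_eq_iff)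

lemma put_block_sweep_point_old:
  "put_block blk i v (sweep_point blk i u v) = sweep_point blk i u v"
  by (auto simp: put_block_def sweep_point_def vec_eq_iff)

text \<open>
  Stated for an arbitrary function \<open>G\<close> of the block variables: block-wise minimality gives
  \<open>G (sweep_point blk (Suc i) u v) \<le> G (sweep_point blk i u v)\<close>, and these inequalities telescope
  from \<open>v\<close> to \<open>u\<close>.
\<close>

lemma x_sweep_descent:
  fixes G :: "real ^ 'p::finite \<Rightarrow> 'b::linorder"
  assumes blocks: "\<And>j. blk j \<in> {1..n}"
    and min: "\<And>i. i \<in> {1..n} \<Longrightarrow>
      is_arg_min (\<lambda>w. G (put_block blk i w (sweep_point blk i u v))) (\<lambda>_. True) u"
  shows "G u \<le> G v"
proof -
  have step: "G (sweep_point blk (Suc i) u v) \<le> G (sweep_point blk i u v)" if "i \<in> {1..n}" for i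
    using min[OF that] unfolding is_arg_min_linorder
    by (metis put_block_sweep_point put_block_sweep_point_old)
  have "m \<le> n \<Longrightarrow> G (sweep_point blk (Suc m) u v) \<le> G (sweep_point blk 1 u v)" for m
  proof (induction m)
    case (Suc m)
    then show ?case using step[of "Suc m"] by fastforce
  qed simp
  moreover have "\<not> blk j < 1" "blk j < Suc n" for j
    using blocks[of j] by auto
  then have "sweep_point blk 1 u v = v" "sweep_point blk (Suc n) u v = u"
    by (simp_all only: sweep_point_def vec_eq_iff vec_lambda_beta if_True if_False simp_thms)
  ultimately show ?thesis by force
qed

section \<open>The augmented Lagrangian along the iteration\<close>

definition constraint_map ::
  "nat \<Rightarrow> ('p::finite \<Rightarrow> nat) \<Rightarrow> (nat \<Rightarrow> real ^ 'p ^ 'q::finite) \<Rightarrow> real ^ 'p \<Rightarrow> real ^ 'q" where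
  "constraint_map n blk A x = (\<Sum>i=1..n. A i *v block blk i x)"

lemma residual_eq: "residual n blk A x z = constraint_map n blk A x - z"
  by (simp add: residual_def constraint_map_def)

lemma aug_lagrangian_ereal:
  assumes "f x = ereal a"
  shows "aug_lagrangian n blk A f h \<rho> x z y =
    ereal (a + h z + y \<bullet> residual n blk A x z + \<rho> / 2 * (norm (residual n blk A x z))\<^sup>2)"
  by (simp add: aug_lagrangian_def assms)

text \<open>
  A sequence that is bounded below and decreases by at least \<open>c * (d k)\<^sup>2\<close> in step \<open>k\<close> leaves only
  a null sequence \<open>d\<close>, since the decreases are summable.
\<close>

lemma sufficient_decrease_imp_convergent:
  fixes L d :: "nat \<Rightarrow> real"
  assumes "c > 0" and dec: "\<And>k. L (Suc k) + c * (d k)\<^sup>2 \<le> L k" and low: "\<And>k. m \<le> L k"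
  obtains l where "L \<longlonglongrightarrow> l" and "d \<longlonglongrightarrow> 0"
proof -
  have "decseq L"
  proof (rule decseq_SucI)
    fix k
    have "0 \<le> c * (d k)\<^sup>2" using \<open>c > 0\<close> by simp
    then show "L (Suc k) \<le> L k" using dec[of k] by linarith
  qed
  then obtain l where l: "L \<longlonglongrightarrow> l"
    using decseq_convergent low by blast
  have gap: "(\<lambda>k. (L k - L (Suc k)) / c) \<longlonglongrightarrow> 0"
    using tendsto_divide[OF tendsto_diff[OF l LIMSEQ_Suc[OF l]] tendsto_const, of c] \<open>c > 0\<close>
    by simp
  have "(\<lambda>k. (d k)\<^sup>2) \<longlonglongrightarrow> 0"
  proof (rule tendsto_sandwich[OF _ _ tendsto_const gap])
    show "\<forall>\<^sub>F k in sequentially. (d k)\<^sup>2 \<le> (L k - L (Suc k)) / c"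
      using dec \<open>c > 0\<close> by (intro always_eventually allI)
        (simp add: pos_le_divide_eq le_diff_eq mult.commute add.commute)
  qed simp
  then have "d \<longlonglongrightarrow> 0" by simp
  with l that show ?thesis by blast
qed

theorem theorem1:
  fixes n :: nat
    and blk :: "'p::finite \<Rightarrow> nat"
    and A :: "nat \<Rightarrow> real ^ 'p ^ 'q::finite"
    and f :: "real ^ 'p \<Rightarrow> ereal"
    and h :: "real ^ 'q \<Rightarrow> real"
    and grad_h :: "real ^ 'q \<Rightarrow> real ^ 'q"
    and H \<rho> :: real
    and x :: "nat \<Rightarrow> real ^ 'p"
    and z y :: "nat \<Rightarrow> real ^ 'q"
  assumes blocks: "\<And>j. blk j \<in> {1..n}"
    and f_proper: "proper_fun f"
    and f_continuous: "continuous_on_dom f"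
    and f_multi_convex: "multi_convex n blk f"
    and h_convex: "convex_on UNIV h"
    and h_gradient: "\<And>v. GDERIV h v :> grad_h v"
    and h_lipschitz: "H-lipschitz_on UNIV grad_h"
    and bounded_below:
      "\<exists>m::real. \<forall>u v. residual n blk A u v = 0 \<longrightarrow> ereal m \<le> objective f h u v"
    and penalty: "\<rho> > 0" "\<rho> > 2 * H"
    and admm: "admm_sequence n blk A f h \<rho> x z y"
    and bounded_seq: "bounded (range (\<lambda>k. (x k, z k, y k)))"
  shows "(\<lambda>k. residual n blk A (x k) (z k)) \<longlonglongrightarrow> 0
       \<and> (\<exists>l::real. (\<lambda>k. objective f h (x k) (z k)) \<longlonglongrightarrow> ereal l)"
proof -
  let ?M = "constraint_map n blk A"
  define r where "r k = residual n blk A (x k) (z k)" for k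
  \<comment> \<open>Only from \<open>k = 1\<close> on is \<open>f (x k)\<close> known to be finite and \<open>y k\<close> tied to \<open>z k\<close>,
    hence the index shifts by \<open>Suc\<close> in the estimates below.\<close>
  define \<phi> where "\<phi> k = real_of_ereal (f (x k))" for k
  define L where "L k = \<phi> k + h (z k) + y k \<bullet> r k + \<rho> / 2 * (norm (r k))\<^sup>2" for k
  have r_eq: "r k = ?M (x k) - z k" for k
    by (simp add: r_def residual_eq)
  have H: "H \<ge> 0"
    using h_lipschitz by (rule lipschitz_on_nonneg)

  note step = admm[unfolded admm_sequence_def Let_def, THEN spec]
  have x_min: "is_arg_min (\<lambda>w. aug_lagrangian n blk A f h \<rho>
        (put_block blk i w (sweep_point blk i (x (Suc k)) (x k))) (z k) (y k))
        (\<lambda>_. True) (x (Suc k))" if "i \<in> {1..n}" for i k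
    using step[THEN conjunct1, THEN bspec, OF that, THEN conjunct1] .
  have z_min: "is_arg_min (\<lambda>v. aug_lagrangian n blk A f h \<rho> (x (Suc k)) v (y k))
        (\<lambda>_. True) (z (Suc k))" for k
    using step[THEN conjunct2, THEN conjunct1, THEN conjunct1] .
  have z_fin: "aug_lagrangian n blk A f h \<rho> (x (Suc k)) (z (Suc k)) (y k) \<noteq> \<infinity>" for k
    using step[THEN conjunct2, THEN conjunct1, THEN conjunct2] .
  have y_step: "y (Suc k) = y k + \<rho> *\<^sub>R r (Suc k)" for k
    using step[THEN conjunct2, THEN conjunct2] unfolding r_def .
  have f_real: "f (x (Suc k)) = ereal (\<phi> (Suc k))" for k
  proof -
    have "f (x (Suc k)) \<noteq> \<infinity>"
      using z_fin[of k] by (auto simp: aug_lagrangian_def)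
    moreover have "f (x (Suc k)) \<noteq> -\<infinity>"
      using f_proper by (simp add: proper_fun_def)
    ultimately show ?thesis
      unfolding \<phi>_def by (cases "f (x (Suc k))") simp_all
  qed

  have z_opt: "grad_h (z (Suc k)) = y k + \<rho> *\<^sub>R (?M (x (Suc k)) - z (Suc k))" for k
  proof (rule z_step_gradient[OF h_gradient])
    fix v
    have "aug_lagrangian n blk A f h \<rho> (x (Suc k)) (z (Suc k)) (y k)
        \<le> aug_lagrangian n blk A f h \<rho> (x (Suc k)) v (y k)"
      using z_min[of k] by (simp add: is_arg_min_linorder)
    then show "h (z (Suc k)) + y k \<bullet> (?M (x (Suc k)) - z (Suc k))
          + \<rho> / 2 * (norm (?M (x (Suc k)) - z (Suc k)))\<^sup>2
        \<le> h v + y k \<bullet> (?M (x (Suc k)) - v) + \<rho> / 2 * (norm (?M (x (Suc k)) - v))\<^sup>2"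
      by (simp add: aug_lagrangian_ereal[where f = f, OF f_real] residual_eq)
  qed
  have y_grad: "y (Suc k) = grad_h (z (Suc k))" for k
    by (simp add: z_opt y_step r_eq)

  have y_lip: "norm (y (Suc (Suc k)) - y (Suc k)) \<le> H * norm (z (Suc (Suc k)) - z (Suc k))" for k
    using lipschitz_onD[OF h_lipschitz, of "z (Suc (Suc k))" "z (Suc k)"]
    by (simp add: y_grad dist_norm)
  have r_step: "r (Suc k) = (1 / \<rho>) *\<^sub>R (y (Suc k) - y k)" for k
    using y_step[of k] penalty(1) by simp
  have r_lip: "norm (r (Suc (Suc k))) \<le> H / \<rho> * norm (z (Suc (Suc k)) - z (Suc k))" for k
    using y_lip[of k] penalty(1) by (simp add: r_step divide_right_mono)

  \<comment> \<open>Per unit of \<open>(norm (z (k+1) - z k))\<^sup>2\<close>: what the \<open>z\<close>-update gains, minus what the dual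
    ascent step loses.\<close>
  define c where "c = \<rho> / 2 - H\<^sup>2 / \<rho>"
  have "c > 0"
  proof -
    have "(2 * H)\<^sup>2 < \<rho>\<^sup>2"
      using penalty H by (intro power_strict_mono) auto
    then have "4 * H\<^sup>2 < \<rho>\<^sup>2"
      by (simp only: power_mult_distrib) simp
    then have "0 < (\<rho>\<^sup>2 - 2 * H\<^sup>2) / (2 * \<rho>)"
      using penalty(1) zero_le_power2[of H] by (intro divide_pos_pos; linarith)
    also have "(\<rho>\<^sup>2 - 2 * H\<^sup>2) / (2 * \<rho>) = c"
      using penalty(1) by (simp add: c_def diff_divide_distrib power2_eq_square)
    finally show ?thesis .
  qed

  have descent: "L (Suc (Suc k)) + c * (norm (z (Suc (Suc k)) - z (Suc k)))\<^sup>2 \<le> L (Suc k)" for k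
  proof -
    let ?x = "x (Suc (Suc k))" and ?z = "z (Suc k)" and ?w = "z (Suc (Suc k))" and ?y = "y (Suc k)"
    let ?d = "(norm (?w - ?z))\<^sup>2"
    have "aug_lagrangian n blk A f h \<rho> ?x ?z ?y \<le> aug_lagrangian n blk A f h \<rho> (x (Suc k)) ?z ?y"
      by (rule x_sweep_descent[where G = "\<lambda>u. aug_lagrangian n blk A f h \<rho> u ?z ?y", OF blocks x_min])
    then have "\<phi> (Suc (Suc k)) + h ?z + ?y \<bullet> (?M ?x - ?z) + \<rho> / 2 * (norm (?M ?x - ?z))\<^sup>2 \<le> L (Suc k)"
      by (simp add: aug_lagrangian_ereal[where f = f, OF f_real] L_def r_eq residual_eq)
    moreover have "h ?w + ?y \<bullet> r (Suc (Suc k)) + \<rho> / 2 * (norm (r (Suc (Suc k))))\<^sup>2 + \<rho> / 2 * ?d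
        \<le> h ?z + ?y \<bullet> (?M ?x - ?z) + \<rho> / 2 * (norm (?M ?x - ?z))\<^sup>2"
      using z_step_descent[OF h_convex h_gradient z_opt[of "Suc k"], of ?z]
      by (simp add: r_eq norm_minus_commute)
    moreover have "y (Suc (Suc k)) \<bullet> r (Suc (Suc k))
        = ?y \<bullet> r (Suc (Suc k)) + \<rho> * (norm (r (Suc (Suc k))))\<^sup>2"
      by (simp add: y_step[of "Suc k"] inner_add_left power2_norm_eq_inner)
    moreover have "\<rho> * (norm (r (Suc (Suc k))))\<^sup>2 \<le> H\<^sup>2 / \<rho> * ?d"
    proof -
      have "\<rho> * (norm (r (Suc (Suc k))))\<^sup>2 \<le> \<rho> * (H / \<rho> * norm (?w - ?z))\<^sup>2"
        using r_lip[of k] penalty(1) by (intro mult_left_mono power_mono) auto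
      also have "\<dots> = H\<^sup>2 / \<rho> * ?d"
        using penalty(1) by (simp add: power_mult_distrib power_divide power2_eq_square)
      finally show ?thesis .
    qed
    moreover have "c * ?d = \<rho> / 2 * ?d - H\<^sup>2 / \<rho> * ?d"
      by (simp add: c_def left_diff_distrib)
    ultimately show ?thesis
      unfolding L_def[of "Suc (Suc k)"] by linarith
  qed

  obtain m where m: "\<And>u v. residual n blk A u v = 0 \<Longrightarrow> ereal m \<le> objective f h u v"
    using bounded_below by blast
  have lower: "m \<le> L (Suc k)" for k
  proof -
    let ?r = "r (Suc k)"
    have "ereal m \<le> objective f h (x (Suc k)) (?M (x (Suc k)))"
      by (rule m) (simp add: residual_eq)
    then have "m \<le> \<phi> (Suc k) + h (?M (x (Suc k)))"
      by (simp add: objective_def f_real)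
    moreover have "h (?M (x (Suc k))) \<le> h (z (Suc k)) + y (Suc k) \<bullet> ?r + H * (norm ?r)\<^sup>2"
      using convex_lipschitz_gradient_upper_bound[OF h_convex h_gradient h_lipschitz,
          of "?M (x (Suc k))" "z (Suc k)"] by (simp add: y_grad r_eq)
    moreover have "H * (norm ?r)\<^sup>2 \<le> \<rho> / 2 * (norm ?r)\<^sup>2"
      using penalty by (intro mult_right_mono) auto
    ultimately show ?thesis
      unfolding L_def by linarith
  qed

  obtain l where L_lim: "(\<lambda>k. L (Suc k)) \<longlonglongrightarrow> l"
    and z_diff: "(\<lambda>k. norm (z (Suc (Suc k)) - z (Suc k))) \<longlonglongrightarrow> 0"
    using sufficient_decrease_imp_convergent[where L = "\<lambda>k. L (Suc k)", OF \<open>c > 0\<close> descent lower]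
    by blast

  have "(\<lambda>k. r (Suc (Suc k))) \<longlonglongrightarrow> 0"
    by (rule Lim_null_comparison[OF always_eventually tendsto_mult_right_zero[OF z_diff]])
      (use r_lip in blast)
  then have "(\<lambda>k. r (Suc k)) \<longlonglongrightarrow> 0"
    by (rule LIMSEQ_imp_Suc)
  then have r_lim: "r \<longlonglongrightarrow> 0"
    by (rule LIMSEQ_imp_Suc)

  have "bounded (range y)"
    using bounded_snd[OF bounded_snd[OF bounded_seq]] by (simp add: image_image)
  then obtain B where B: "\<And>k. norm (y k) \<le> B"
    by (auto simp: bounded_iff)
  have yr_lim: "(\<lambda>k. y k \<bullet> r k) \<longlonglongrightarrow> 0"
  proof (rule Lim_null_comparison[OF always_eventually])
    have "norm (y k \<bullet> r k) \<le> B * norm (r k)" for k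
      unfolding real_norm_def
      by (rule order_trans[OF Cauchy_Schwarz_ineq2 mult_right_mono[OF B norm_ge_zero]])
    then show "\<forall>k. norm (y k \<bullet> r k) \<le> B * norm (r k)"
      by blast
    show "(\<lambda>k. B * norm (r k)) \<longlonglongrightarrow> 0"
      by (intro tendsto_mult_right_zero tendsto_norm_zero r_lim)
  qed
  have "(\<lambda>k. \<rho> / 2 * (norm (r k))\<^sup>2) \<longlonglongrightarrow> 0"
    by (rule tendsto_mult_right_zero[OF tendsto_null_power[OF tendsto_norm_zero[OF r_lim] pos2]])
  note F_lim = tendsto_diff[OF tendsto_diff[OF L_lim LIMSEQ_Suc[OF yr_lim]] LIMSEQ_Suc[OF this]]
  have "objective f h (x (Suc k)) (z (Suc k))
      = ereal (L (Suc k) - y (Suc k) \<bullet> r (Suc k) - \<rho> / 2 * (norm (r (Suc k)))\<^sup>2)" for k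
    by (simp add: objective_def f_real L_def)
  then have "(\<lambda>k. objective f h (x (Suc k)) (z (Suc k))) \<longlonglongrightarrow> ereal l"
    using F_lim by (simp only: lim_ereal diff_zero)
  then have "(\<lambda>k. objective f h (x k) (z k)) \<longlonglongrightarrow> ereal l"
    by (rule LIMSEQ_imp_Suc)
  with r_lim show ?thesis
    unfolding r_def by blast
qed

end
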